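(* Let $b_1^{q_1}\dots b_r^{q_r}$ be an alternating binary sequence with $q_1\ge 2$ specifying a threshold graph $G$ on $n=\sum_{k=1}^r q_k$ nodes with block degrees $p_1,\dots,p_r$, and let $C=C(G)$ be its condensed signless Laplacian, with eigenvalues $\lambda_1(C)\le\dots\le\lambda_r(C)$. Then $$(0\le)\quad \lambda_1(C)\le p_{r-b_r}\le \lambda_2(C)\le p_{r-b_r-2}\le\dots\le \lambda_{\frac{r-b_r-b_1+1}{2}}(C)\le p_{1+b_1}$$ and $$p_{2-b_1}-1\le \lambda_{\frac{r-b_r-b_1+1}{2}+1}(C)\le p_{4-b_1}-1\le \lambda_{\frac{r-b_r-b_1+1}{2}+2}(C)\le\dots\le p_{r-(1-b_r)}-1\le\lambda_r(C).$$
   Context: A sequence $b_1^{q_1}\dots b_r^{q_r}$ with $b_k\in\{0,1\}$ and positive integers $q_k$ denotes the binary string of length $n=\sum_{k=1}^r q_k$ in which digit $b_k$ is repeated $q_k$ times in block $k$. It is alternating if $b_k+b_{k+1}=1$ for $k=1,\dots,r-1$. Put $n_0=0$ and $n_k=\sum_{h=1}^k q_h$. The threshold graph $G=([n],E)$ specified by the sequence has edge set given, for $1\le i<j\le n$, by: $\{i,j\}\in E$ if and only if there is $k\in\{1,\dots,r\}$ with $n_{k-1}<j\le n_k$ and $b_k=1$ (i.e., digit $0$ adds an isolated vertex, digit $1$ adds a vertex adjacent to all previous vertices). All nodes of block $k$ have the same degree $p_k$ (the block degree), where $p_k=\sum_{h=k}^r b_hq_h$ if $b_k=0$, and $p_k=\sum_{h=1}^k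 q_h-1+\sum_{h=k+1}^r b_hq_h$ if $b_k=1$. The condensed signless Laplacian $C(G)$ is the symmetric $r\times r$ matrix with diagonal entries $C_{kk}=p_k+b_k(q_k-1)$ and off-diagonal entries $C_{ij}=C_{ji}=b_j\sqrt{q_iq_j}$ for $1\le i<j\le r$. Eigenvalues of a symmetric matrix are numbered in nondecreasing order. In the first chain the indices of $p$ run in steps of $2$ from $r-b_r$ down to $1+b_1$ (exactly the indices $k$ with $b_k=0$); in the second chain they run in steps of $2$ from $2-b_1$ up to $r-(1-b_r)$ (exactly the indices $k$ with $b_k=1$). A chain with no such indices is empty. *)

theory Defs
  imports "Jordan_Normal_Form.Char_Poly"
begin

text \<open>
  A binary sequence of \<open>r\<close> blocks, where block \<open>k\<close> repeats the digit \<open>b k\<close> exactly \<open>q k\<close> times, is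
  given by \<open>b, q :: nat \<Rightarrow> nat\<close> and \<open>r\<close>; only the values at \<open>1, \<dots>, r\<close> matter. Blocks and vertices are numbered from 1.
\<close>

definition block_end :: "(nat \<Rightarrow> nat) \<Rightarrow> nat \<Rightarrow> nat" where
  "block_end q k = (\<Sum>h=1..k. q h)"

definition threshold_edges :: "(nat \<Rightarrow> nat) \<Rightarrow> (nat \<Rightarrow> nat) \<Rightarrow> nat \<Rightarrow> nat set set" where
  "threshold_edges b q r =
     {{i, j} | i j. 1 \<le> i \<and> i < j \<and> j \<le> block_end q r \<and>
        (\<exists>k\<in>{1..r}. block_end q (k - 1) < j \<and> j \<le> block_end q k \<and> b k = 1)}"

definition vertex_degree :: "'a set set \<Rightarrow> 'a \<Rightarrow> nat" where
  "vertex_degree E v = card {w. {v, w} \<in> E}"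

text \<open>
  The degree of the last vertex of block \<open>k\<close>; \<open>vertex_degree_eq_block_degree\<close> below shows that
  all vertices of the block have this degree.
\<close>

definition block_degree :: "(nat \<Rightarrow> nat) \<Rightarrow> (nat \<Rightarrow> nat) \<Rightarrow> nat \<Rightarrow> nat \<Rightarrow> nat" where
  "block_degree b q r k = vertex_degree (threshold_edges b q r) (block_end q k)"

text \<open>Matrix indices start at 0, so the entry \<open>(i, j)\<close> belongs to the blocks \<open>i + 1\<close> and \<open>j + 1\<close>.\<close>

definition condensed_signless_laplacian :: "(nat \<Rightarrow> nat) \<Rightarrow> (nat \<Rightarrow> nat) \<Rightarrow> nat \<Rightarrow> real mat" where
  "condensed_signless_laplacian b q r = mat r r (\<lambda>(i, j).
     if i = j
     then real (block_degree b q r (i + 1)) + real (b (i + 1)) * (real (q (i + 1)) - 1)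
     else real (b (max i j + 1)) * sqrt (real (q (i + 1)) * real (q (j + 1))))"

text \<open>
  The \<open>k\<close>-th smallest real eigenvalue, counted from 1 and with multiplicity. It is meaningful
  for \<open>1 \<le> k \<le> dim_row A\<close> if the characteristic polynomial of \<open>A\<close> splits over the reals, in
  particular if \<open>A\<close> is symmetric.
\<close>

definition nth_eigenvalue :: "real mat \<Rightarrow> nat \<Rightarrow> real" where
  "nth_eigenvalue A k = sorted_list_of_multiset (proots (char_poly A)) ! (k - 1)"

lemma block_end_mono: "k \<le> l \<Longrightarrow> block_end q k \<le> block_end q l"
  unfolding block_end_def by (rule sum_mono2) auto

lemma block_end_Suc: "block_end q (Suc k) = block_end q k + q (Suc k)"
  unfolding block_end_def by simp

definition digit_one :: "(nat \<Rightarrow> nat) \<Rightarrow> (nat \<Rightarrow> nat) \<Rightarrow> nat \<Rightarrow> nat \<Rightarrow> bool" where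
  "digit_one b q r j \<longleftrightarrow>
     (\<exists>k\<in>{1..r}. block_end q (k - 1) < j \<and> j \<le> block_end q k \<and> b k = 1)"

lemma block_unique:
  assumes "block_end q (k - 1) < j" "j \<le> block_end q k"
    and "block_end q (l - 1) < j" "j \<le> block_end q l"
  shows "k = l"
proof (rule ccontr)
  assume "k \<noteq> l"
  then consider "k \<le> l - 1" | "l \<le> k - 1" by linarith
  then show False
    using assms block_end_mono[of k "l - 1" q] block_end_mono[of l "k - 1" q] by cases auto
qed

lemma digit_one_iff:
  assumes "k \<in> {1..r}" "block_end q (k - 1) < j" "j \<le> block_end q k"
  shows "digit_one b q r j \<longleftrightarrow> b k = 1"
  using assms block_unique[of q k j] unfolding digit_one_def by metis

lemma threshold_edge_iff:
  assumes "i < j"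
  shows "{i, j} \<in> threshold_edges b q r \<longleftrightarrow> 1 \<le> i \<and> j \<le> block_end q r \<and> digit_one b q r j"
  using assms unfolding threshold_edges_def digit_one_def by (auto simp: doubleton_eq_iff)

lemma threshold_no_loop: "{i} \<notin> threshold_edges b q r"
  unfolding threshold_edges_def by (auto simp: singleton_insert_inj_eq)

lemma card_later_ones:
  assumes "\<And>h. h \<in> {1..r} \<Longrightarrow> b h \<in> {0, 1}" and "k \<le> s" "s \<le> r"
  shows "card {j. block_end q k < j \<and> j \<le> block_end q s \<and> digit_one b q r j}
         = (\<Sum>h=k+1..s. b h * q h)"
  using \<open>k \<le> s\<close> \<open>s \<le> r\<close>
proof (induction s rule: dec_induct)
  case base
  show ?case by simp
next
  case (step s)
  let ?S = "\<lambda>a c. {j. block_end q a < j \<and> j \<le> block_end q c \<and> digit_one b q r j}"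
  have split: "?S k (Suc s) = ?S k s \<union> ?S s (Suc s)"
    using block_end_mono[OF step(1), of q] block_end_Suc[of q s] by auto
  have fin: "finite (?S a c)" for a c
    by (rule finite_subset[of _ "{..block_end q c}"]) auto
  have one: "?S s (Suc s) = (if b (Suc s) = 1 then {block_end q s<..block_end q (Suc s)} else {})"
    using digit_one_iff[of "Suc s" r q _ b] step(4) by auto
  have "b (Suc s) \<in> {0, 1}" using assms(1) step(4) by auto
  then have "card (?S s (Suc s)) = b (Suc s) * q (Suc s)"
    unfolding one by (auto simp: block_end_Suc)
  moreover have "card (?S k (Suc s)) = card (?S k s) + card (?S s (Suc s))"
    unfolding split by (rule card_Un_disjoint) (use fin in auto)
  ultimately show ?case using step by simp
qed

lemma vertex_degree_threshold:
  assumes b: "\<And>h. h \<in> {1..r} \<Longrightarrow> b h \<in> {0, 1}" and k: "k \<in> {1..r}"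
    and v: "block_end q (k - 1) < v" "v \<le> block_end q k"
  shows "vertex_degree (threshold_edges b q r) v
         = (if b k = 0 then (\<Sum>h=k..r. b h * q h)
            else (\<Sum>h=1..k. q h) - 1 + (\<Sum>h=k+1..r. b h * q h))"
proof -
  let ?E = "threshold_edges b q r"
  let ?L = "{j. block_end q k < j \<and> j \<le> block_end q r \<and> digit_one b q r j}"
  let ?B = "if b k = 1 then {1..block_end q k} - {v} else {}"
  have kr: "block_end q k \<le> block_end q r" using k by (simp add: block_end_mono)
  have same: "digit_one b q r w \<longleftrightarrow> b k = 1"
    if "block_end q (k - 1) < w" "w \<le> block_end q k" for w
    using digit_one_iff[OF k that] .
  have "{v, w} \<in> ?E \<longleftrightarrow> w \<in> ?B \<union> ?L" for w
  proof (cases w v rule: linorder_cases)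
    case less
    then show ?thesis
      using threshold_edge_iff[OF less, of b q r] same[OF v] v kr by (auto simp: insert_commute)
  next
    case equal
    then show ?thesis using threshold_no_loop[of v b q r] v by auto
  next
    case greater
    then show ?thesis
      using threshold_edge_iff[OF greater, of b q r] same[of w] v kr
      by (cases "w \<le> block_end q k") auto
  qed
  then have "{w. {v, w} \<in> ?E} = ?B \<union> ?L" by blast
  moreover have "finite ?L" by (rule finite_subset[of _ "{..block_end q r}"]) auto
  ultimately have "vertex_degree ?E v = card ?B + card ?L"
    unfolding vertex_degree_def by (simp only:, subst card_Un_disjoint) auto
  also have "card ?L = (\<Sum>h=k+1..r. b h * q h)"
    using card_later_ones[of r b k r q] b k by simp
  also have "card ?B = (if b k = 1 then (\<Sum>h=1..k. q h) - 1 else 0)"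
    using v by (simp add: block_end_def)
  finally show ?thesis
    using b[OF k] k by (auto simp: sum.atLeast_Suc_atMost)
qed

lemma vertex_degree_eq_block_degree:
  assumes "\<And>h. h \<in> {1..r} \<Longrightarrow> b h \<in> {0, 1}" and "k \<in> {1..r}"
    and "block_end q (k - 1) < v" "v \<le> block_end q k"
  shows "vertex_degree (threshold_edges b q r) v = block_degree b q r k"
  unfolding block_degree_def using assms
  by (subst (1 2) vertex_degree_threshold[of r b k q]) auto

lemma block_degree_eq:
  assumes "\<And>h. h \<in> {1..r} \<Longrightarrow> b h \<in> {0, 1}" and "k \<in> {1..r}" and "q k > 0"
  shows "block_degree b q r k
         = (if b k = 0 then (\<Sum>h=k..r. b h * q h)
            else (\<Sum>h=1..k. q h) - 1 + (\<Sum>h=k+1..r. b h * q h))"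
  unfolding block_degree_def using assms block_end_Suc[of q "k - 1"]
  by (intro vertex_degree_threshold) auto

end

theory Submission
  imports Defs "Jordan_Normal_Form.Schur_Decomposition"
begin

text \<open>
  Write a vector on the \<open>r\<close> blocks as \<open>y\<close>, and spread \<open>y k\<close> evenly over the vertices of block \<open>k\<close>, so that
  each of them carries \<open>y k / sqrt (q k)\<close>. This preserves the norm, and the quadratic form of the
  condensed matrix becomes the sum of \<open>(x\<^sub>u + x\<^sub>v)\<^sup>2\<close> over the edges of the threshold graph
  (\<open>condensed_form_eq_edge_form\<close>). In particular it is nonnegative. All other bounds follow from
  the Courant-Fischer principle in the following form (\<open>le_nth_eigenvalue_if_form_ge\<close>,
  \<open>nth_eigenvalue_le_if_form_le\<close>): if the form is at least \<open>c |y|\<^sup>2\<close> on a subspace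
  cut out by fewer than \<open>k\<close> linear equations, then \<open>\<lambda>\<^sub>k \<ge> c\<close>; if it is at most \<open>c |y|\<^sup>2\<close> on a subspace
  cut out by at most \<open>r - k\<close> equations, then \<open>\<lambda>\<^sub>k \<le> c\<close>.
  
  The subspaces are as follows, where a block is called a zero or a one after its digit, \<open>n\<^sub>k\<close> is the
  number of vertices up to block \<open>k\<close>, and \<open>L\<^sub>k\<close> the number of vertices in the ones after block \<open>k\<close>.
  
  \<^item> Upper bounds \<open>p\<^sub>k\<close> for a zero \<open>k\<close>: vectors supported on the zeros from \<open>k\<close> on. No two zeros are
    adjacent, so the form is diagonal there, and the degrees of zeros decrease along the sequence.
  
  \<^item> Lower bounds \<open>p\<^sub>k\<close> for a zero \<open>k\<close>: vectors that vanish on the zeros after \<open>k\<close> and have vertex sum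
    \<open>0\<close> over the blocks up to \<open>k\<close>. The \<open>L\<^sub>k = p\<^sub>k\<close> vertices in the later ones form a clique joined to
    all the first \<open>n\<^sub>k\<close> vertices. The mixed terms of the join cancel because of the vertex sum, so the
    form has at least the factor \<open>L\<^sub>k\<close> on the first \<open>n\<^sub>k\<close> vertices and \<open>n\<^sub>k + L\<^sub>k - 2 \<ge> L\<^sub>k\<close> on the clique.
  
  \<^item> Lower bounds \<open>p\<^sub>k - 1\<close> for a one \<open>k\<close>: vectors supported on the ones from \<open>k\<close> on. These ones
    form a clique, so the form is diagonal with entries \<open>p\<^sub>h - 1\<close> plus the square of the vertex sum,
    and the degrees of ones increase along the sequence.
  
  \<^item> Upper bounds \<open>p\<^sub>k - 1\<close> for a one \<open>k\<close>: vectors that vanish on the ones after \<open>k\<close> and have vertex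
    sum \<open>0\<close> over the blocks up to \<open>k\<close>. The graph on the first \<open>n\<^sub>k\<close> vertices is part of a complete
    graph, whose form is \<open>(n\<^sub>k - 2) |x|\<^sup>2\<close> plus the square of the vertex sum, and the \<open>L\<^sub>k\<close> vertices in the
    later ones add at most \<open>L\<^sub>k |x|\<^sup>2\<close>.
  
  The condition \<open>q 1 \<ge> 2\<close> enters as \<open>n\<^sub>k \<ge> 2\<close>. What remains is to count the equations, that is, the zeros and
  ones before and after a given block.
\<close>

section \<open>Spectral decomposition of real symmetric matrices\<close>

lemma eigenvalue_symmetric_real:
  fixes A :: "real mat"
  assumes A: "A \<in> carrier_mat n n" and sym: "A\<^sup>T = A"
    and ev: "eigenvalue (map_mat complex_of_real A) e"
  shows "e \<in> \<real>"
proof -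
  let ?A = "map_mat complex_of_real A"
  have cA: "?A \<in> carrier_mat n n" using A by simp
  from ev obtain v where v: "v \<in> carrier_vec n" "v \<noteq> 0\<^sub>v n" and eig: "?A *\<^sub>v v = e \<cdot>\<^sub>v v"
    unfolding eigenvalue_def eigenvector_def using A by auto
  have cv: "conjugate v \<in> carrier_vec n" using v by simp
  have symc: "?A\<^sup>T = ?A" using sym by (simp add: map_mat_transpose)
  have "conjugate (?A *\<^sub>v v) = ?A *\<^sub>v conjugate v"
    using A v by (intro eq_vecI) (auto simp: scalar_prod_def sum_conjugate)
  then have eigc: "?A *\<^sub>v conjugate v = conjugate e \<cdot>\<^sub>v conjugate v"
    unfolding eig by (simp add: conjugate_smult_vec)
  have "e * (v \<bullet> conjugate v) = (?A *\<^sub>v v) \<bullet> conjugate v"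
    unfolding eig using v cv by simp
  also have "\<dots> = v \<bullet> (?A *\<^sub>v conjugate v)"
    using transpose_vec_mult_scalar[OF cA cv v(1)] symc by simp
  also have "\<dots> = conjugate e * (v \<bullet> conjugate v)"
    unfolding eigc using v cv by simp
  finally have "e = conjugate e"
    using conjugate_square_eq_0_vec[OF v(1)] v(2) by simp
  then show ?thesis by (metis Reals_cnj_iff conjugate_complex_def)
qed

lemma char_poly_symmetric_splits:
  fixes A :: "real mat"
  assumes A: "A \<in> carrier_mat n n" and sym: "A\<^sup>T = A"
  shows "\<exists>es. char_poly A = (\<Prod>e\<leftarrow>es. [:- e, 1:])"
proof -
  interpret c: map_poly_inj_idom_hom complex_of_real ..
  let ?A = "map_mat complex_of_real A"
  have cA: "?A \<in> carrier_mat n n" using A by simp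
  from char_poly_factorized[OF cA] obtain zs where
    zs: "char_poly ?A = (\<Prod>z\<leftarrow>zs. [:- z, 1:])" by blast
  have "z \<in> \<real>" if "z \<in> set zs" for z
  proof (rule eigenvalue_symmetric_real[OF A sym])
    show "eigenvalue ?A z"
      unfolding eigenvalue_root_char_poly[OF cA] zs poly_prod_list using that
      by (auto simp: prod_list_zero_iff)
  qed
  then have "zs = map complex_of_real (map Re zs)"
    by (simp add: map_idI)
  then have "map_poly complex_of_real (char_poly A)
      = (\<Prod>z\<leftarrow>map complex_of_real (map Re zs). [:- z, 1:])"
    using of_real_hom.char_poly_hom[OF A, where 'a = complex] zs by simp
  also have "\<dots> = map_poly complex_of_real (\<Prod>e\<leftarrow>map Re zs. [:- e, 1:])"
    by (simp add: c.hom_prod_list o_def)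
  finally have "char_poly A = (\<Prod>e\<leftarrow>map Re zs. [:- e, 1:])" by (simp only: c.eq_iff)
  then show ?thesis by blast
qed

text \<open>
  Gram-Schmidt yields orthogonal vectors of arbitrary lengths. They are scaled to unit length here so
  that products of such matrices remain orthogonal in the induction below.
\<close>

lemma orthonormal_completion:
  fixes v :: "real vec"
  assumes v: "v \<in> carrier_vec n" "v \<noteq> 0\<^sub>v n"
  obtains W c where "W \<in> carrier_mat n n" "W\<^sup>T * W = 1\<^sub>m n" "col W 0 = c \<cdot>\<^sub>v v"
proof -
  interpret cof_vec_space n "TYPE(real)" .
  define ws where "ws = gram_schmidt n (basis_completion v)"
  note b = basis_completion[OF v]
  have n: "n \<noteq> 0" using v by (cases n) auto
  note ws = gram_schmidt_result[OF b(2,4,5) ws_def]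
  have len: "length ws = n" using ws(4) b(6) by simp
  have "hd ws = v"
    unfolding ws_def using gram_schmidt_hd[OF v(1)] b(6,7) n
    by (metis hd_Cons_tl length_0_conv)
  then have ws0: "ws ! 0 = v" using len n by (metis hd_conv_nth length_0_conv)
  have wc: "ws ! i \<in> carrier_vec n" if "i < n" for i
    using ws(3) len that by (metis nth_mem subsetD)
  have orth: "ws ! i \<bullet> ws ! j = 0 \<longleftrightarrow> i \<noteq> j" if "i < n" "j < n" for i j
    using ws(2) that len unfolding corthogonal_def by simp
  define c where "c i = 1 / sqrt (ws ! i \<bullet> ws ! i)" for i
  define W where "W = mat_of_cols n (map (\<lambda>i. c i \<cdot>\<^sub>v ws ! i) [0..<n])"
  have W: "W \<in> carrier_mat n n" unfolding W_def carrier_mat_def by simp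
  have col: "col W i = c i \<cdot>\<^sub>v ws ! i" if "i < n" for i
    unfolding W_def using that wc by (subst col_mat_of_cols) auto
  have "W\<^sup>T * W = 1\<^sub>m n"
  proof (rule eq_matI)
    fix i j assume "i < dim_row (1\<^sub>m n)" "j < dim_col (1\<^sub>m n)"
    then have ij: "i < n" "j < n" by auto
    have "(W\<^sup>T * W) $$ (i, j) = c i * c j * (ws ! i \<bullet> ws ! j)"
      using W ij carrier_vecD[OF wc[OF ij(1)]] carrier_vecD[OF wc[OF ij(2)]] by (simp add: col)
    also have "\<dots> = (if i = j then 1 else 0)"
    proof (cases "i = j")
      case True
      have "ws ! i \<bullet> ws ! i > 0"
        using conjugate_square_ge_0_vec[of "ws ! i"] orth[OF ij(1) ij(1)]
        by (simp add: less_le)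
      then show ?thesis using True by (simp add: c_def)
    qed (use orth ij in auto)
    finally show "(W\<^sup>T * W) $$ (i, j) = 1\<^sub>m n $$ (i, j)" using ij by simp
  qed (use W in auto)
  then show ?thesis using that[OF W _ ] col[of 0] ws0 n by auto
qed

text \<open>
  The proof is by deflation: conjugation with an orthonormal basis whose first element is an eigenvector
  for \<open>e\<close> splits off \<open>e\<close> as a \<open>1 \<times> 1\<close> block, because symmetry clears the rest of the first row as
  well as of the first column. The eigenvalues may be listed in any order, which allows them to be
  sorted later.
\<close>

theorem spectral_decomposition:
  fixes A :: "real mat"
  assumes "A \<in> carrier_mat n n" "A\<^sup>T = A" "char_poly A = (\<Prod>e\<leftarrow>es. [:- e, 1:])"
  shows "\<exists>U\<in>carrier_mat n n. U\<^sup>T * U = 1\<^sub>m n \<and>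
    U\<^sup>T * A * U = mat n n (\<lambda>(i, j). if i = j then es ! i else 0)"
  using assms
proof (induction es arbitrary: n A)
  case Nil
  then have "n = 0" using degree_monic_char_poly[of A n] by simp
  then show ?case using Nil by (intro bexI[of _ "1\<^sub>m 0"]) (auto intro!: eq_matI)
next
  case (Cons e es)
  note A = Cons.prems(1) and sym = Cons.prems(2)
  have "eigenvalue A e"
    unfolding eigenvalue_root_char_poly[OF A] Cons.prems(3) by simp
  then obtain v where v: "v \<in> carrier_vec n" "v \<noteq> 0\<^sub>v n" and eig: "A *\<^sub>v v = e \<cdot>\<^sub>v v"
    unfolding eigenvalue_def eigenvector_def using A by auto
  obtain W c where W: "W \<in> carrier_mat n n" and WW: "W\<^sup>T * W = 1\<^sub>m n" and W0: "col W 0 = c \<cdot>\<^sub>v v"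
    using orthonormal_completion[OF v] .
  obtain m where n: "n = Suc m" using v by (cases n) auto
  have WT: "W\<^sup>T \<in> carrier_mat n n" using W by simp
  have WW': "W * W\<^sup>T = 1\<^sub>m n" using mat_mult_left_right_inverse[OF WT W WW] .
  define B where "B = W\<^sup>T * A * W"
  have B: "B \<in> carrier_mat n n" unfolding B_def using W A by simp
  have symB: "B\<^sup>T = B"
    unfolding B_def using W A WT sym
    by (simp add: transpose_mult[of _ n n _ n] assoc_mult_mat[of _ n n _ n _ n])
  have B0: "B $$ (i, 0) = (if i = 0 then e else 0)" if "i < n" for i
  proof -
    have "col (A * W) 0 = A *\<^sub>v (c \<cdot>\<^sub>v v)"
      using col_mult2[OF A W, of 0] n W0 by simp
    also have "\<dots> = e \<cdot>\<^sub>v col W 0"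
      unfolding mult_mat_vec[OF A v(1)] eig W0 by (simp add: smult_smult_assoc mult.commute)
    finally have "col (A * W) 0 = e \<cdot>\<^sub>v col W 0" .
    moreover have "B $$ (i, 0) = col W i \<bullet> col (A * W) 0"
      unfolding B_def using that n W A WT by (subst assoc_mult_mat[of _ n n _ n _ n]) auto
    moreover have "col W i \<bullet> col W 0 = (W\<^sup>T * W) $$ (i, 0)" using that n W by simp
    ultimately show ?thesis using that n W by (simp add: WW)
  qed
  define C where "C = mat m m (\<lambda>(i, j). B $$ (Suc i, Suc j))"
  have C: "C \<in> carrier_mat m m" unfolding C_def by simp
  have Bsym: "B $$ (i, j) = B $$ (j, i)" if "i < n" "j < n" for i j
    using symB B that by (metis carrier_matD index_transpose_mat(1))
  have symC: "C\<^sup>T = C" unfolding C_def using n Bsym by (auto intro!: eq_matI)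
  let ?E = "mat 1 1 (\<lambda>_. e)"
  have blk: "B = four_block_mat ?E (0\<^sub>m 1 m) (0\<^sub>m m 1) C"
  proof (rule eq_matI)
    fix i j assume "i < dim_row (four_block_mat ?E (0\<^sub>m 1 m) (0\<^sub>m m 1) C)"
      "j < dim_col (four_block_mat ?E (0\<^sub>m 1 m) (0\<^sub>m m 1) C)"
    then have ij: "i < n" "j < n" using n C by auto
    then show "B $$ (i, j) = four_block_mat ?E (0\<^sub>m 1 m) (0\<^sub>m m 1) C $$ (i, j)"
      using B0[of i] B0[of j] Bsym[of 0 j] n C_def by (cases i; cases j) auto
  qed (use B n C in auto)
  have simil: "similar_mat B A"
    unfolding similar_mat_def
    by (intro exI[of _ "W\<^sup>T"] exI[of _ W] similar_mat_witI[of _ _ n])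
       (use W WT A B WW WW' B_def in auto)
  have "[:- e, 1:] * char_poly C = char_poly B"
    unfolding blk by (subst char_poly_four_block_zeros_col[OF _ _ C])
       (auto simp: char_poly_defs det_def sign_def)
  also have "\<dots> = [:- e, 1:] * (\<Prod>e\<leftarrow>es. [:- e, 1:])"
    using char_poly_similar[OF simil] Cons.prems(3) by simp
  finally have "char_poly C = (\<Prod>e\<leftarrow>es. [:- e, 1:])"
    by (metis mult_cancel_left pCons_eq_0_iff zero_neq_one)
  from Cons.IH[OF C symC this] obtain V where V: "V \<in> carrier_mat m m" and VV: "V\<^sup>T * V = 1\<^sub>m m"
    and VC: "V\<^sup>T * C * V = mat m m (\<lambda>(i, j). if i = j then es ! i else 0)" by blast
  let ?V = "four_block_mat (1\<^sub>m 1) (0\<^sub>m 1 m) (0\<^sub>m m 1) V"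
  have V': "?V \<in> carrier_mat n n" using four_block_carrier_mat[OF _ V, of "1\<^sub>m 1" 1 1] n by simp
  have VT: "?V\<^sup>T = four_block_mat (1\<^sub>m 1) (0\<^sub>m 1 m) (0\<^sub>m m 1) V\<^sup>T"
    using V by (subst transpose_four_block_mat[of _ 1 1 _ m _ m]) auto
  have VV': "?V\<^sup>T * ?V = 1\<^sub>m n"
    unfolding VT using V VV n by (subst mult_four_block_mat[of _ 1 1 _ m _ m _ _ 1 _ m]) auto
  have "?V\<^sup>T * B * ?V = four_block_mat ?E (0\<^sub>m 1 m) (0\<^sub>m m 1) (V\<^sup>T * C * V)"
    unfolding VT blk using V C
    by (subst mult_four_block_mat[of _ 1 1 _ m _ m _ _ 1 _ m]; simp?)+
  also have "\<dots> = mat n n (\<lambda>(i, j). if i = j then (e # es) ! i else 0)"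
    unfolding VC n by (rule eq_matI) (auto simp: nth_Cons split: nat.split)
  finally have D: "?V\<^sup>T * B * ?V = mat n n (\<lambda>(i, j). if i = j then (e # es) ! i else 0)" .
  have VT': "?V\<^sup>T \<in> carrier_mat n n" using V' by simp
  have UT: "(W * ?V)\<^sup>T = ?V\<^sup>T * W\<^sup>T" using W V' by (rule transpose_mult)
  have "(W * ?V)\<^sup>T * (W * ?V) = ?V\<^sup>T * ((W\<^sup>T * W) * ?V)"
    unfolding UT using W V' VT' WT by (simp add: assoc_mult_mat[of _ n n _ n _ n])
  then have 1: "(W * ?V)\<^sup>T * (W * ?V) = 1\<^sub>m n"
    by (simp only: WW left_mult_one_mat[OF V'] VV')
  have 2: "(W * ?V)\<^sup>T * A * (W * ?V) = ?V\<^sup>T * B * ?V"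
    unfolding UT B_def using W V' VT' WT A by (simp add: assoc_mult_mat[of _ n n _ n _ n])
  show ?case using 1 2 D W V' by (intro bexI[of _ "W * ?V"]) auto
qed

section \<open>The Courant-Fischer principle\<close>

lemma exists_nonzero_orthogonal_vector:
  fixes S :: "'a::field vec set"
  assumes S: "finite S" "S \<subseteq> carrier_vec n" and card: "card S < n"
  obtains x where "x \<in> carrier_vec n" "x \<noteq> 0\<^sub>v n" "\<And>s. s \<in> S \<Longrightarrow> s \<bullet> x = 0"
proof -
  obtain ss where ss: "set ss = S" "distinct ss" using finite_distinct_list[OF S(1)] by blast
  have len: "length ss < n" using distinct_card[OF ss(2)] ss(1) card by simp
  have ssc: "ss ! i \<in> carrier_vec n" if "i < length ss" for i
    using ss(1) S(2) that nth_mem by blast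
  \<comment> \<open>Padding with zero rows makes the homogeneous system square, and singular.\<close>
  define M where "M = mat\<^sub>r n n (\<lambda>i. if i < length ss then ss ! i else 0\<^sub>v n)"
  have M: "M \<in> carrier_mat n n" unfolding M_def by simp
  have "M = mat\<^sub>r n n (\<lambda>i. if i = length ss then 0\<^sub>v n else if i < length ss then ss ! i else 0\<^sub>v n)"
    unfolding M_def by (intro eq_rowI) auto
  also have "det \<dots> = 0"
    by (rule det_row_0[OF len]) (use ssc in auto)
  finally obtain x where x: "x \<in> carrier_vec n" "x \<noteq> 0\<^sub>v n" "M *\<^sub>v x = 0\<^sub>v n"
    using det_0_iff_vec_prod_zero_field[OF M] by blast
  have "s \<bullet> x = 0" if "s \<in> S" for s
  proof -
    obtain i where i: "i < length ss" "s = ss ! i" using \<open>s \<in> S\<close> ss(1) by (metis in_set_conv_nth)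
    have "(M *\<^sub>v x) $ i = s \<bullet> x" using i len ssc x(1) by (simp add: M_def)
    then show ?thesis using x(3) i len by simp
  qed
  with x(1,2) show ?thesis by (rule that)
qed

lemma nth_eigenvalue_eq_nth_sort:
  assumes "char_poly A = (\<Prod>e\<leftarrow>es. [:- e, 1:])"
  shows "nth_eigenvalue A k = sort es ! (k - 1)"
proof -
  have "proots (\<Prod>e\<leftarrow>es. [:- e, 1:]) = mset es"
  proof (induction es)
    case (Cons e es)
    have "(\<Prod>e\<leftarrow>es. [:- e, 1:]) \<noteq> 0" by (auto simp: prod_list_zero_iff)
    then show ?case using Cons by (simp add: proots_mult del: mult_pCons_left)
  qed simp
  then show ?thesis unfolding nth_eigenvalue_def assms by simp
qed

text \<open>
  The spectral decomposition in the form used below: with respect to an orthonormal basis of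
  eigenvectors, listed by increasing eigenvalue, the quadratic form of \<open>A\<close> is diagonal.
\<close>

lemma eigenvalue_coordinates:
  fixes A :: "real mat"
  assumes A: "A \<in> carrier_mat n n" and sym: "A\<^sup>T = A"
  obtains u where "\<And>i. i < n \<Longrightarrow> u i \<in> carrier_vec n"
    and "\<And>x. x \<in> carrier_vec n \<Longrightarrow> x \<bullet> x = (\<Sum>i<n. (u i \<bullet> x)\<^sup>2)"
    and "\<And>x. x \<in> carrier_vec n \<Longrightarrow>
      x \<bullet> (A *\<^sub>v x) = (\<Sum>i<n. nth_eigenvalue A (i + 1) * (u i \<bullet> x)\<^sup>2)"
proof -
  obtain es where es: "char_poly A = (\<Prod>e\<leftarrow>es. [:- e, 1:])"
    using char_poly_symmetric_splits[OF A sym] by blast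
  have "char_poly A = (\<Prod>e\<leftarrow>sort es. [:- e, 1:])"
    unfolding es by (simp flip: prod_mset_prod_list)
  from spectral_decomposition[OF A sym this] obtain U where
    U: "U \<in> carrier_mat n n" and UU: "U\<^sup>T * U = 1\<^sub>m n"
    and D: "U\<^sup>T * A * U = mat n n (\<lambda>(i, j). if i = j then sort es ! i else 0)" (is "_ = ?D") by blast
  have UT: "U\<^sup>T \<in> carrier_mat n n" using U by simp
  have UU': "U * U\<^sup>T = 1\<^sub>m n" using mat_mult_left_right_inverse[OF UT U UU] .
  have DU: "A = U * ?D * U\<^sup>T"
  proof -
    have "U * ?D * U\<^sup>T = (U * U\<^sup>T) * A * (U * U\<^sup>T)"
      unfolding D[symmetric] using U UT A by (simp add: assoc_mult_mat[of _ n n _ n _ n])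
    then show ?thesis using UU' A by simp
  qed
  have move: "x \<bullet> (U *\<^sub>v z) = (U\<^sup>T *\<^sub>v x) \<bullet> z" if "x \<in> carrier_vec n" "z \<in> carrier_vec n" for x z
    using transpose_vec_mult_scalar[OF U that(2,1)] by simp
  show ?thesis
  proof (rule that[of "col U"])
    fix x :: "real vec" assume x: "x \<in> carrier_vec n"
    have y: "U\<^sup>T *\<^sub>v x \<in> carrier_vec n" using UT x by simp
    have yi: "(U\<^sup>T *\<^sub>v x) $ i = col U i \<bullet> x" if "i < n" for i
      using that U x by simp
    have "x = U *\<^sub>v (U\<^sup>T *\<^sub>v x)"
      using UU' U UT x by (simp flip: assoc_mult_mat_vec[of _ n n _ n])
    then have "x \<bullet> x = (U\<^sup>T *\<^sub>v x) \<bullet> (U\<^sup>T *\<^sub>v x)" using move[OF x y] by simp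
    also have "\<dots> = (\<Sum>i<n. (col U i \<bullet> x)\<^sup>2)"
      unfolding scalar_prod_def[of "U\<^sup>T *\<^sub>v x"] carrier_vecD[OF y]
      by (rule sum.cong) (auto simp: power2_eq_square yi simp del: index_mult_mat_vec)
    finally show "x \<bullet> x = (\<Sum>i<n. (col U i \<bullet> x)\<^sup>2)" .
    have D': "?D \<in> carrier_mat n n" by simp
    have "A *\<^sub>v x = U *\<^sub>v (?D *\<^sub>v (U\<^sup>T *\<^sub>v x))"
      by (subst DU) (use U UT D' x in \<open>simp add: assoc_mult_mat_vec[of _ n n _ n]\<close>)
    then have "x \<bullet> (A *\<^sub>v x) = (U\<^sup>T *\<^sub>v x) \<bullet> (?D *\<^sub>v (U\<^sup>T *\<^sub>v x))"
      using move[OF x mult_mat_vec_carrier[OF D' y]] by simp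
    also have "?D *\<^sub>v (U\<^sup>T *\<^sub>v x) = vec n (\<lambda>i. sort es ! i * (col U i \<bullet> x))"
    proof (rule eq_vecI)
      fix i assume "i < dim_vec (vec n (\<lambda>i. sort es ! i * (col U i \<bullet> x)))"
      then have i: "i < n" by simp
      have "(?D *\<^sub>v (U\<^sup>T *\<^sub>v x)) $ i = (\<Sum>j<n. (if i = j then sort es ! i else 0) * (col U j \<bullet> x))"
      proof -
        have "(?D *\<^sub>v (U\<^sup>T *\<^sub>v x)) $ i = row ?D i \<bullet> (U\<^sup>T *\<^sub>v x)" using i by simp
        also have "\<dots> = (\<Sum>j<n. (if i = j then sort es ! i else 0) * (col U j \<bullet> x))"
          unfolding scalar_prod_def[of "row ?D i"] carrier_vecD[OF y]
          by (rule sum.cong) (use i in \<open>auto simp: yi simp del: index_mult_mat_vec\<close>)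
        finally show ?thesis .
      qed
      also have "\<dots> = sort es ! i * (col U i \<bullet> x)"
        using i by (subst sum.cong[OF refl, of _ _ "\<lambda>j. if j = i then sort es ! i * (col U i \<bullet> x) else 0"]) auto
      finally show "(?D *\<^sub>v (U\<^sup>T *\<^sub>v x)) $ i = vec n (\<lambda>i. sort es ! i * (col U i \<bullet> x)) $ i" using i by simp
    qed simp
    also have "(U\<^sup>T *\<^sub>v x) \<bullet> \<dots> = (\<Sum>i<n. nth_eigenvalue A (i + 1) * (col U i \<bullet> x)\<^sup>2)"
      unfolding scalar_prod_def[of "U\<^sup>T *\<^sub>v x"] nth_eigenvalue_eq_nth_sort[OF es] dim_vec
      by (rule sum.cong) (auto simp: power2_eq_square yi simp del: index_mult_mat_vec)
    finally show "x \<bullet> (A *\<^sub>v x) = (\<Sum>i<n. nth_eigenvalue A (i + 1) * (col U i \<bullet> x)\<^sup>2)" .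
  qed (use U in simp)
qed

lemma nth_eigenvalue_mono:
  fixes A :: "real mat"
  assumes A: "A \<in> carrier_mat n n" "A\<^sup>T = A" and "1 \<le> i" "i \<le> j" "j \<le> n"
  shows "nth_eigenvalue A i \<le> nth_eigenvalue A j"
proof -
  obtain es where es: "char_poly A = (\<Prod>e\<leftarrow>es. [:- e, 1:])"
    using char_poly_symmetric_splits[OF A] by blast
  have "length es = n"
    using degree_monic_char_poly[OF A(1)] degree_linear_factors[of uminus es] es by simp
  then show ?thesis
    unfolding nth_eigenvalue_eq_nth_sort[OF es] using assms by (intro sorted_nth_mono) auto
qed

lemma inner_self_pos:
  fixes x :: "real vec"
  assumes "x \<in> carrier_vec n" "x \<noteq> 0\<^sub>v n"
  shows "x \<bullet> x > 0"
  using conjugate_square_greater_0_vec[OF assms(1)] assms(2) by simp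

text \<open>
  The span of the first \<open>k\<close> eigenvectors, on which the form is at most \<open>\<lambda>\<^sub>k |x|\<^sup>2\<close>, has larger dimension
  than the number of equations given by \<open>S\<close>. So it contains a nonzero solution \<open>x\<close> of these
  equations, and comparing the two bounds at \<open>x\<close> gives the claim.
\<close>

theorem le_nth_eigenvalue_if_form_ge:
  fixes A :: "real mat"
  assumes A: "A \<in> carrier_mat n n" "A\<^sup>T = A"
    and S: "finite S" "S \<subseteq> carrier_vec n" "card S < k" "k \<le> n"
    and ge: "\<And>x. x \<in> carrier_vec n \<Longrightarrow> (\<And>s. s \<in> S \<Longrightarrow> s \<bullet> x = 0) \<Longrightarrow> c * (x \<bullet> x) \<le> x \<bullet> (A *\<^sub>v x)"
  shows "c \<le> nth_eigenvalue A k"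
proof -
  obtain u where u: "\<And>i. i < n \<Longrightarrow> u i \<in> carrier_vec n"
    and norm: "\<And>x. x \<in> carrier_vec n \<Longrightarrow> x \<bullet> x = (\<Sum>i<n. (u i \<bullet> x)\<^sup>2)"
    and form: "\<And>x. x \<in> carrier_vec n \<Longrightarrow>
      x \<bullet> (A *\<^sub>v x) = (\<Sum>i<n. nth_eigenvalue A (i + 1) * (u i \<bullet> x)\<^sup>2)"
    using eigenvalue_coordinates[OF A] by blast
  have "card (S \<union> u ` {k..<n}) \<le> card S + card (u ` {k..<n})" by (rule card_Un_le)
  also have "\<dots> \<le> card S + (n - k)" using card_image_le[of "{k..<n}" u] by simp
  finally have "card (S \<union> u ` {k..<n}) < n" using S by simp
  moreover have "finite (S \<union> u ` {k..<n})" "S \<union> u ` {k..<n} \<subseteq> carrier_vec n"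
    using S u by auto
  ultimately obtain x where x: "x \<in> carrier_vec n" "x \<noteq> 0\<^sub>v n"
    and orth: "\<And>s. s \<in> S \<union> u ` {k..<n} \<Longrightarrow> s \<bullet> x = 0"
    using exists_nonzero_orthogonal_vector by metis
  have "nth_eigenvalue A (i + 1) * (u i \<bullet> x)\<^sup>2 \<le> nth_eigenvalue A k * (u i \<bullet> x)\<^sup>2" if "i < n" for i
  proof (cases "i < k")
    case True
    then show ?thesis using nth_eigenvalue_mono[OF A, of "i + 1" k] S(4) by (intro mult_right_mono) auto
  next
    case False
    then show ?thesis using orth[of "u i"] that by simp
  qed
  then have "x \<bullet> (A *\<^sub>v x) \<le> nth_eigenvalue A k * (x \<bullet> x)"
    unfolding form[OF x(1)] norm[OF x(1)] sum_distrib_left by (intro sum_mono) auto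
  with ge[OF x(1)] orth have "c * (x \<bullet> x) \<le> nth_eigenvalue A k * (x \<bullet> x)" by force
  with inner_self_pos[OF x] show ?thesis by simp
qed

text \<open>
  The dual argument uses the span of the eigenvectors from the \<open>k\<close>-th on, which is cut out by
  \<open>k - 1\<close> equations.
\<close>

theorem nth_eigenvalue_le_if_form_le:
  fixes A :: "real mat"
  assumes A: "A \<in> carrier_mat n n" "A\<^sup>T = A"
    and S: "finite S" "S \<subseteq> carrier_vec n" "card S + k \<le> n" "1 \<le> k"
    and le: "\<And>x. x \<in> carrier_vec n \<Longrightarrow> (\<And>s. s \<in> S \<Longrightarrow> s \<bullet> x = 0) \<Longrightarrow> x \<bullet> (A *\<^sub>v x) \<le> c * (x \<bullet> x)"
  shows "nth_eigenvalue A k \<le> c"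
proof -
  obtain u where u: "\<And>i. i < n \<Longrightarrow> u i \<in> carrier_vec n"
    and norm: "\<And>x. x \<in> carrier_vec n \<Longrightarrow> x \<bullet> x = (\<Sum>i<n. (u i \<bullet> x)\<^sup>2)"
    and form: "\<And>x. x \<in> carrier_vec n \<Longrightarrow>
      x \<bullet> (A *\<^sub>v x) = (\<Sum>i<n. nth_eigenvalue A (i + 1) * (u i \<bullet> x)\<^sup>2)"
    using eigenvalue_coordinates[OF A] by blast
  have "card (S \<union> u ` {..<k - 1}) \<le> card S + card (u ` {..<k - 1})" by (rule card_Un_le)
  also have "\<dots> \<le> card S + (k - 1)" using card_image_le[of "{..<k - 1}" u] by simp
  finally have "card (S \<union> u ` {..<k - 1}) < n" using S by simp
  moreover have "finite (S \<union> u ` {..<k - 1})" "S \<union> u ` {..<k - 1} \<subseteq> carrier_vec n"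
    using S u by auto
  ultimately obtain x where x: "x \<in> carrier_vec n" "x \<noteq> 0\<^sub>v n"
    and orth: "\<And>s. s \<in> S \<union> u ` {..<k - 1} \<Longrightarrow> s \<bullet> x = 0"
    using exists_nonzero_orthogonal_vector by metis
  have "nth_eigenvalue A k * (u i \<bullet> x)\<^sup>2 \<le> nth_eigenvalue A (i + 1) * (u i \<bullet> x)\<^sup>2" if "i < n" for i
  proof (cases "i < k - 1")
    case True
    then show ?thesis using orth[of "u i"] that by simp
  next
    case False
    then show ?thesis
      using nth_eigenvalue_mono[OF A, of k "i + 1"] S(4) that by (intro mult_right_mono) auto
  qed
  then have "nth_eigenvalue A k * (x \<bullet> x) \<le> x \<bullet> (A *\<^sub>v x)"
    unfolding form[OF x(1)] norm[OF x(1)] sum_distrib_left by (intro sum_mono) auto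
  with le[OF x(1)] orth have "nth_eigenvalue A k * (x \<bullet> x) \<le> c * (x \<bullet> x)" by force
  with inner_self_pos[OF x] show ?thesis by simp
qed

section \<open>The quadratic form of a threshold graph on block vectors\<close>

text \<open>
  A block vector \<open>y\<close> stands for the vertex vector with value \<open>y i / sqrt (q i)\<close> on each vertex of block
  \<open>i\<close>. The functions \<open>mass\<close> and \<open>vertex_sum\<close> are the squared norm and the sum of the entries of this
  vertex vector, restricted to the first \<open>l\<close> blocks.
\<close>

definition mass :: "(nat \<Rightarrow> real) \<Rightarrow> nat \<Rightarrow> real" where
  "mass y l = (\<Sum>i=1..l. (y i)\<^sup>2)"

definition vertex_sum :: "(nat \<Rightarrow> nat) \<Rightarrow> (nat \<Rightarrow> real) \<Rightarrow> nat \<Rightarrow> real" where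
  "vertex_sum q y l = (\<Sum>i=1..l. sqrt (q i) * y i)"

definition ones_between :: "(nat \<Rightarrow> nat) \<Rightarrow> (nat \<Rightarrow> nat) \<Rightarrow> nat \<Rightarrow> nat \<Rightarrow> real" where
  "ones_between b q k l = (\<Sum>h=k+1..l. real (b h * q h))"

text \<open>
  The sum of \<open>(x\<^sub>u + x\<^sub>v)\<^sup>2\<close> over the edges within the first \<open>l\<close> blocks, for the vertex vector \<open>x\<close> that
  belongs to \<open>y\<close>. If \<open>b j = 1\<close>, then the \<open>q i * q j\<close> edges between blocks \<open>i < j\<close>
  contribute \<open>q i * q j * (y i / sqrt (q i) + y j / sqrt (q j))\<^sup>2\<close>, and the \<open>q j * (q j - 1) / 2\<close> edges inside
  block \<open>j\<close> contribute \<open>4 * (y j)\<^sup>2 / q j\<close> each.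
\<close>

definition edge_form :: "(nat \<Rightarrow> nat) \<Rightarrow> (nat \<Rightarrow> nat) \<Rightarrow> (nat \<Rightarrow> real) \<Rightarrow> nat \<Rightarrow> real" where
  "edge_form b q y l = (\<Sum>j=1..l. b j *
     ((\<Sum>i=1..<j. (sqrt (q j) * y i + sqrt (q i) * y j)\<^sup>2) + 2 * (real (q j) - 1) * (y j)\<^sup>2))"

lemma mass_mono: "k \<le> l \<Longrightarrow> mass y k \<le> mass y l"
  unfolding mass_def by (intro sum_mono2) auto

lemma mass_Suc: "mass y (Suc l) = mass y l + (y (Suc l))\<^sup>2"
  unfolding mass_def by simp

lemma vertex_sum_Suc: "vertex_sum q y (Suc l) = vertex_sum q y l + sqrt (q (Suc l)) * y (Suc l)"
  unfolding vertex_sum_def by simp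

lemma ones_between_self [simp]: "ones_between b q k k = 0"
  unfolding ones_between_def by simp

lemma ones_between_Suc:
  "k \<le> l \<Longrightarrow> ones_between b q k (Suc l) = ones_between b q k l + real (b (Suc l) * q (Suc l))"
  unfolding ones_between_def by simp

lemma ones_between_nonneg: "0 \<le> ones_between b q k l"
  unfolding ones_between_def by (intro sum_nonneg) simp

lemma block_end_add_ones_between:
  assumes "\<And>h. h \<in> {1..l} \<Longrightarrow> b h \<in> {0, 1}" and "k \<le> l"
  shows "real (block_end q k) + ones_between b q k l \<le> block_end q l"
  using assms(2,1)
proof (induction l rule: dec_induct)
  case (step l)
  have "b (Suc l) \<in> {0, 1}" using step.prems by simp
  then show ?case using step by (fastforce simp: block_end_Suc ones_between_Suc)
qed simp

lemma sum_squares_expand: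
  fixes z :: real
  shows "(\<Sum>i=1..l. (sqrt (real c) * y i + sqrt (q i) * z)\<^sup>2)
   = c * mass y l + block_end q l * z\<^sup>2 + 2 * (sqrt c * z) * vertex_sum q y l"
  unfolding mass_def block_end_def vertex_sum_def
  by (simp add: power2_sum power_mult_distrib sum.distrib sum_distrib_left sum_distrib_right
      mult.assoc mult.left_commute mult.commute)

lemma edge_form_Suc:
  "edge_form b q y (Suc l) = edge_form b q y l + b (Suc l) *
     (q (Suc l) * mass y l + (real (block_end q l) + 2 * q (Suc l) - 2) * (y (Suc l))\<^sup>2
      + 2 * (sqrt (q (Suc l)) * y (Suc l)) * vertex_sum q y l)"
proof -
  have "edge_form b q y (Suc l) = edge_form b q y l + b (Suc l) *
      ((\<Sum>i=1..l. (sqrt (q (Suc l)) * y i + sqrt (q i) * y (Suc l))\<^sup>2)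
       + 2 * (real (q (Suc l)) - 1) * (y (Suc l))\<^sup>2)"
    unfolding edge_form_def by (simp add: atLeastLessThanSuc_atLeastAtMost)
  then show ?thesis unfolding sum_squares_expand by (simp add: algebra_simps)
qed

lemma edge_form_nonneg:
  assumes "\<And>h. h \<in> {1..l} \<Longrightarrow> q h \<ge> 1"
  shows "0 \<le> edge_form b q y l"
  unfolding edge_form_def using assms
  by (intro sum_nonneg mult_nonneg_nonneg add_nonneg_nonneg) auto

text \<open>
  The right-hand side is the form of the complete graph on the same vertices, so the difference is a sum
  of squares over the missing edges. In the induction, adding a block of digit \<open>1\<close> increases both sides
  equally, and a block of digit \<open>0\<close> increases only the right-hand side, by the nonnegative \<open>?inc\<close>.
\<close>

lemma edge_form_le_complete:
  assumes "\<And>h. h \<in> {1..l} \<Longrightarrow> b h \<in> {0, 1}" "\<And>h. h \<in> {1..l} \<Longrightarrow> q h \<ge> 1"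
  shows "edge_form b q y l \<le> (real (block_end q l) - 2) * mass y l + (vertex_sum q y l)\<^sup>2"
  using assms
proof (induction l)
  case 0
  then show ?case by (simp add: edge_form_def mass_def vertex_sum_def)
next
  case (Suc l)
  let ?q = "real (q (Suc l))" and ?y = "y (Suc l)"
  let ?s = "sqrt ?q"
  let ?inc = "?q * mass y l + (real (block_end q l) + 2 * ?q - 2) * ?y\<^sup>2
      + 2 * (?s * ?y) * vertex_sum q y l"
  have "?inc = (\<Sum>i=1..l. (?s * y i + sqrt (q i) * ?y)\<^sup>2) + 2 * (?q - 1) * ?y\<^sup>2"
    using sum_squares_expand[of "q (Suc l)" y q ?y l] by (simp only:) (simp add: algebra_simps)
  moreover have "?q \<ge> 1" using Suc.prems(2)[of "Suc l"] by simp
  ultimately have "0 \<le> ?inc" by (simp add: sum_nonneg)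
  moreover have "b (Suc l) \<in> {0, 1}" using Suc.prems(1) by simp
  ultimately have "edge_form b q y (Suc l) \<le> edge_form b q y l + ?inc"
    unfolding edge_form_Suc by auto
  also have "\<dots> \<le> (real (block_end q l) - 2) * mass y l + (vertex_sum q y l)\<^sup>2 + ?inc"
    using Suc by simp
  also have "\<dots> = (real (block_end q (Suc l)) - 2) * mass y (Suc l) + (vertex_sum q y (Suc l))\<^sup>2"
    by (simp add: block_end_Suc mass_Suc vertex_sum_Suc power2_sum power_mult_distrib algebra_simps)
  finally show ?case .
qed

text \<open>
  If \<open>y\<close> vanishes on the ones after block \<open>k\<close>, then an edge to such a block contributes only the square of
  the value at its other end. So every vertex gains at most one such square for each vertex in these ones.
\<close>

lemma edge_form_tail_upper:
  assumes "\<And>h. h \<in> {k<..l} \<Longrightarrow> b h = 0 \<or> b h = 1 \<and> y h = 0" and "k \<le> l"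
  shows "edge_form b q y l \<le> edge_form b q y k + ones_between b q k l * mass y l"
  using assms(2,1)
proof (induction l rule: dec_induct)
  case (step l)
  have IH: "edge_form b q y l \<le> edge_form b q y k + ones_between b q k l * mass y l"
    using step by auto
  have "b (Suc l) = 0 \<or> b (Suc l) = 1 \<and> y (Suc l) = 0" using step by auto
  moreover have "0 \<le> ones_between b q k l * (y (Suc l))\<^sup>2"
    by (simp add: ones_between_nonneg)
  ultimately show ?case
    using IH step.hyps by (auto simp: edge_form_Suc ones_between_Suc mass_Suc algebra_simps)
qed simp

text \<open>
  If \<open>y\<close> vanishes on the zeros after block \<open>k\<close>, then the support consists of the first \<open>k\<close> blocks and of a
  clique joined to all of them. With \<open>n\<close> vertices up to block \<open>k\<close> and \<open>L\<close> vertices in the clique, the edges of the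
  join and the clique give exactly the left-hand side: the factor \<open>L\<close> for the first blocks, the factor
  \<open>n + L - 2\<close> for the clique, and mixed terms that make up the difference of the squared vertex sums.
  Edges from the zeros after block \<open>k\<close> account for the inequality.
\<close>

lemma edge_form_tail_lower:
  assumes "\<And>h. h \<in> {1..l} \<Longrightarrow> b h \<in> {0, 1}"
    and "\<And>h. h \<in> {k<..l} \<Longrightarrow> b h = 0 \<Longrightarrow> y h = 0" and "k \<le> l"
  shows "ones_between b q k l * mass y k
      + (real (block_end q k) + ones_between b q k l - 2) * (mass y l - mass y k)
      + (vertex_sum q y l)\<^sup>2 - (vertex_sum q y k)\<^sup>2
    \<le> edge_form b q y l - edge_form b q y k"
  using assms(3,1,2)
proof (induction l rule: dec_induct)
  case (step l)
  let ?L = "ones_between b q k l" and ?q = "real (q (Suc l))" and ?y = "y (Suc l)"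
  let ?s = "sqrt ?q"
  have IH: "?L * mass y k + (real (block_end q k) + ?L - 2) * (mass y l - mass y k)
      + (vertex_sum q y l)\<^sup>2 - (vertex_sum q y k)\<^sup>2
    \<le> edge_form b q y l - edge_form b q y k"
    using step by auto
  show ?case
  proof (cases "b (Suc l) = 0")
    case True
    then have "?y = 0" using step by auto
    then show ?thesis
      using IH True step.hyps by (simp add: edge_form_Suc ones_between_Suc mass_Suc vertex_sum_Suc)
  next
    case False
    then have b: "b (Suc l) = 1" using step.prems(1)[of "Suc l"] by auto
    have "(real (block_end q k) + ?L) * ?y\<^sup>2 \<le> real (block_end q l) * ?y\<^sup>2"
      using step by (intro mult_right_mono block_end_add_ones_between) auto
    then show ?thesis
      using IH b step.hyps
      by (simp add: edge_form_Suc ones_between_Suc mass_Suc vertex_sum_Suc power2_sum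
          power_mult_distrib algebra_simps)
  qed
qed simp

text \<open>
  The sum over edges, sorted by entries \<open>y i * y j\<close>. The diagonal depends on \<open>l\<close>, since a vertex gains
  neighbours with each later block of digit \<open>1\<close>; this form of the statement lends itself to induction on \<open>l\<close>.
\<close>

lemma edge_form_eq_matrix_form:
  "edge_form b q y l
   = (\<Sum>i=1..l. (ones_between b q i l + b i * (real (block_end q i) + q i - 2)) * (y i)\<^sup>2)
     + (\<Sum>j=1..l. \<Sum>i\<in>{1..l} - {j}. b (max i j) * sqrt (real (q i) * q j) * y i * y j)"
proof (induction l)
  case 0
  then show ?case by (simp add: edge_form_def)
next
  case (Suc l)
  let ?c = "\<lambda>i j. b (max i j) * sqrt (real (q i) * q j) * y i * y j"
  let ?e = "\<lambda>i. b i * (real (block_end q i) + q i - 2)"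
  let ?b = "real (b (Suc l))" and ?q = "real (q (Suc l))" and ?y = "y (Suc l)"
  have diag: "(\<Sum>i=1..Suc l. (ones_between b q i (Suc l) + ?e i) * (y i)\<^sup>2)
      = (\<Sum>i=1..l. (ones_between b q i l + ?e i) * (y i)\<^sup>2) + ?b * ?q * mass y l + ?e (Suc l) * ?y\<^sup>2"
  proof -
    have "(\<Sum>i=1..l. (ones_between b q i (Suc l) + ?e i) * (y i)\<^sup>2)
        = (\<Sum>i=1..l. (ones_between b q i l + ?e i) * (y i)\<^sup>2 + ?b * ?q * (y i)\<^sup>2)"
      by (intro sum.cong) (auto simp: ones_between_Suc algebra_simps)
    then show ?thesis by (simp add: mass_def sum.distrib sum_distrib_left)
  qed
  have cross: "(\<Sum>i=1..l. ?c i (Suc l)) = ?b * (sqrt ?q * ?y) * vertex_sum q y l"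
    unfolding vertex_sum_def sum_distrib_left
    by (intro sum.cong) (auto simp: real_sqrt_mult max_def)
  have "(\<Sum>j=1..Suc l. \<Sum>i\<in>{1..Suc l} - {j}. ?c i j)
      = (\<Sum>j=1..l. \<Sum>i\<in>{1..Suc l} - {j}. ?c i j) + (\<Sum>i=1..l. ?c i (Suc l))"
  proof -
    have "{1..Suc l} - {Suc l} = {1..l}" by auto
    then show ?thesis by simp
  qed
  also have "(\<Sum>j=1..l. \<Sum>i\<in>{1..Suc l} - {j}. ?c i j)
      = (\<Sum>j=1..l. (\<Sum>i\<in>{1..l} - {j}. ?c i j) + ?c (Suc l) j)"
  proof (rule sum.cong)
    fix j assume "j \<in> {1..l}"
    then have "{1..Suc l} - {j} = insert (Suc l) ({1..l} - {j})" by auto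
    then show "(\<Sum>i\<in>{1..Suc l} - {j}. ?c i j) = (\<Sum>i\<in>{1..l} - {j}. ?c i j) + ?c (Suc l) j"
      by simp
  qed simp
  also have "\<dots> = (\<Sum>j=1..l. \<Sum>i\<in>{1..l} - {j}. ?c i j) + (\<Sum>i=1..l. ?c i (Suc l))"
    by (simp add: sum.distrib max.commute mult.commute mult.left_commute)
  finally have off: "(\<Sum>j=1..Suc l. \<Sum>i\<in>{1..Suc l} - {j}. ?c i j)
    = (\<Sum>j=1..l. \<Sum>i\<in>{1..l} - {j}. ?c i j) + 2 * (?b * (sqrt ?q * ?y) * vertex_sum q y l)"
    unfolding cross by simp
  show ?case
    unfolding diag off edge_form_Suc Suc.IH by (simp add: block_end_Suc algebra_simps)
qed

section \<open>The form of the condensed signless Laplacian\<close>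

locale alternating_threshold_sequence =
  fixes b q :: "nat \<Rightarrow> nat" and r :: nat
  assumes r: "r \<ge> 1"
    and b01: "\<And>k. k \<in> {1..r} \<Longrightarrow> b k \<in> {0, 1}"
    and q: "\<And>k. k \<in> {1..r} \<Longrightarrow> q k \<ge> 1"
    and alternating: "\<And>k. k \<in> {1..<r} \<Longrightarrow> b k + b (k + 1) = 1"
    and q1: "q 1 \<ge> 2"
begin

definition p :: "nat \<Rightarrow> real" where
  "p k = real (block_degree b q r k)"

definition lam :: "nat \<Rightarrow> real" where
  "lam = nth_eigenvalue (condensed_signless_laplacian b q r)"

lemma block_degree_ones_between:
  assumes "k \<in> {1..r}"
  shows "p k = ones_between b q k r + b k * (real (block_end q k) - 1)"
proof -
  have "q k \<le> block_end q k" unfolding block_end_def using assms by (intro member_le_sum) auto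
  then have "1 \<le> block_end q k" using q[OF assms] by simp
  moreover have "p k = real (if b k = 0 then (\<Sum>h=k..r. b h * q h)
            else (\<Sum>h=1..k. q h) - 1 + (\<Sum>h=k+1..r. b h * q h))"
    unfolding p_def using q[OF assms] by (subst block_degree_eq[OF b01 assms]) auto
  ultimately show ?thesis
    using b01[OF assms] assms
    by (auto simp: block_end_def ones_between_def of_nat_diff sum.atLeast_Suc_atMost)
qed

lemma two_le_block_end:
  assumes "1 \<le> k"
  shows "2 \<le> block_end q k"
  using q1 block_end_mono[OF assms, of q] by (simp add: block_end_def)

lemma condensed_carrier: "condensed_signless_laplacian b q r \<in> carrier_mat r r"
  unfolding condensed_signless_laplacian_def by simp

lemma condensed_symmetric: "(condensed_signless_laplacian b q r)\<^sup>T = condensed_signless_laplacian b q r"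
  unfolding condensed_signless_laplacian_def
  by (rule eq_matI) (auto simp: max.commute mult.commute)

lemma inner_self_eq_mass:
  assumes "x \<in> carrier_vec r"
  shows "x \<bullet> x = mass (\<lambda>k. x $ (k - 1)) r"
  using carrier_vecD[OF assms]
  by (simp add: scalar_prod_def mass_def sum.atLeast1_atMost_eq power2_eq_square atLeast0LessThan)

lemma condensed_form_eq_edge_form:
  assumes x: "x \<in> carrier_vec r"
  shows "x \<bullet> (condensed_signless_laplacian b q r *\<^sub>v x) = edge_form b q (\<lambda>k. x $ (k - 1)) r"
proof -
  let ?C = "condensed_signless_laplacian b q r" and ?y = "\<lambda>k. x $ (k - 1)"
  have diag: "?C $$ (i - 1, i - 1) = ones_between b q i r + b i * (real (block_end q i) + q i - 2)"
    if "i \<in> {1..r}" for i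
  proof -
    have "i - 1 < r" "i - 1 + 1 = i" using that by auto
    then show ?thesis
      using block_degree_ones_between[OF that]
      by (simp add: condensed_signless_laplacian_def p_def algebra_simps)
  qed
  have off: "?C $$ (j - 1, i - 1) = b (max i j) * sqrt (real (q i) * q j)"
    if "j \<in> {1..r}" "i \<in> {1..r}" "i \<noteq> j" for i j
  proof -
    have "max (j - 1) (i - 1) + 1 = max i j" "j - 1 \<noteq> i - 1" "j - 1 < r" "i - 1 < r"
      "j - 1 + 1 = j" "i - 1 + 1 = i" using that by auto
    then show ?thesis
      by (simp add: condensed_signless_laplacian_def mult.commute)
  qed
  have "(?C *\<^sub>v x) $ j = (\<Sum>i<r. ?C $$ (j, i) * x $ i)" if "j < r" for j
    using that x condensed_carrier by (simp add: scalar_prod_def atLeast0LessThan)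
  then have "x \<bullet> (?C *\<^sub>v x) = (\<Sum>j<r. x $ j * (\<Sum>i<r. ?C $$ (j, i) * x $ i))"
    using condensed_carrier by (simp add: scalar_prod_def[of x] atLeast0LessThan)
  also have "\<dots> = (\<Sum>j<r. \<Sum>i<r. ?C $$ (j, i) * x $ i * x $ j)"
    by (simp add: sum_distrib_left mult.commute)
  also have "\<dots> = (\<Sum>j=1..r. \<Sum>i=1..r. ?C $$ (j - 1, i - 1) * ?y i * ?y j)"
    by (simp add: sum.atLeast1_atMost_eq)
  also have "\<dots> = (\<Sum>j=1..r. ?C $$ (j - 1, j - 1) * (?y j)\<^sup>2
      + (\<Sum>i\<in>{1..r} - {j}. ?C $$ (j - 1, i - 1) * ?y i * ?y j))"
    by (intro sum.cong refl, subst sum.remove) (auto simp: power2_eq_square)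
  also have "\<dots> = (\<Sum>j=1..r. (ones_between b q j r + b j * (real (block_end q j) + q j - 2)) * (?y j)\<^sup>2
      + (\<Sum>i\<in>{1..r} - {j}. b (max i j) * sqrt (real (q i) * q j) * ?y i * ?y j))"
    using diag off by (intro sum.cong arg_cong2[of _ _ _ _ "(+)"]) auto
  finally show ?thesis unfolding edge_form_eq_matrix_form sum.distrib .
qed

text \<open>
  Orthogonality to these vectors expresses that \<open>y\<close> vanishes on \<open>I\<close> and that its vertex sums over the first
  \<open>l\<close> blocks vanish for \<open>l \<in> L\<close>. The bounds use \<open>L = {}\<close> or a single \<open>l\<close>.
\<close>

definition constraint_vectors :: "nat set \<Rightarrow> nat set \<Rightarrow> real vec set" where
  "constraint_vectors I L = (\<lambda>i. unit_vec r (i - 1)) ` I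
     \<union> (\<lambda>l. vec r (\<lambda>i. if i < l then sqrt (q (i + 1)) else 0)) ` L"

lemma constraint_vectors:
  assumes "I \<subseteq> {1..r}" "L \<subseteq> {..r}"
  shows "finite (constraint_vectors I L)" "constraint_vectors I L \<subseteq> carrier_vec r"
    "card (constraint_vectors I L) \<le> card I + card L"
    "\<And>x i. x \<in> carrier_vec r \<Longrightarrow> (\<And>s. s \<in> constraint_vectors I L \<Longrightarrow> s \<bullet> x = 0) \<Longrightarrow>
      i \<in> I \<Longrightarrow> x $ (i - 1) = 0"
    "\<And>x l. x \<in> carrier_vec r \<Longrightarrow> (\<And>s. s \<in> constraint_vectors I L \<Longrightarrow> s \<bullet> x = 0) \<Longrightarrow>
      l \<in> L \<Longrightarrow> vertex_sum q (\<lambda>k. x $ (k - 1)) l = 0"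
proof -
  let ?u = "\<lambda>i. unit_vec r (i - 1) :: real vec"
  let ?w = "\<lambda>l. vec r (\<lambda>i. if i < l then sqrt (real (q (i + 1))) else 0)"
  have fin: "finite I" "finite L" using assms finite_subset by blast+
  show "finite (constraint_vectors I L)" "constraint_vectors I L \<subseteq> carrier_vec r"
    unfolding constraint_vectors_def using fin by auto
  have "card (constraint_vectors I L) \<le> card (?u ` I) + card (?w ` L)"
    unfolding constraint_vectors_def by (rule card_Un_le)
  also have "\<dots> \<le> card I + card L" using fin by (intro add_mono card_image_le)
  finally show "card (constraint_vectors I L) \<le> card I + card L" .
  fix x :: "real vec" assume x: "x \<in> carrier_vec r"
    and orth: "\<And>s. s \<in> constraint_vectors I L \<Longrightarrow> s \<bullet> x = 0"
  show "x $ (i - 1) = 0" if "i \<in> I" for i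
  proof -
    have "i \<in> {1..r}" using that assms(1) by blast
    then have "i - 1 < r" by auto
    moreover have "?u i \<bullet> x = 0" by (rule orth) (use that in \<open>auto simp: constraint_vectors_def\<close>)
    ultimately show ?thesis using x by simp
  qed
  show "vertex_sum q (\<lambda>k. x $ (k - 1)) l = 0" if "l \<in> L" for l
  proof -
    have "?w l \<bullet> x = (\<Sum>i<r. if i < l then sqrt (q (Suc i)) * x $ i else 0)"
      using x by (simp add: scalar_prod_def atLeast0LessThan if_distrib[of "\<lambda>z. z * _"] cong: if_cong)
    also have "\<dots> = (\<Sum>i<l. sqrt (q (Suc i)) * x $ i)"
      using that assms(2) by (intro sum.mono_neutral_cong_right) auto
    finally have "?w l \<bullet> x = vertex_sum q (\<lambda>k. x $ (k - 1)) l"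
      by (simp add: vertex_sum_def sum.atLeast1_atMost_eq)
    moreover have "?w l \<bullet> x = 0" by (rule orth) (use that in \<open>auto simp: constraint_vectors_def\<close>)
    ultimately show ?thesis by simp
  qed
qed

lemma le_lam_if_edge_form_ge:
  assumes IL: "I \<subseteq> {1..r}" "L \<subseteq> {..r}" "card I + card L < k" "k \<le> r"
    and ge: "\<And>y. (\<And>i. i \<in> I \<Longrightarrow> y i = 0) \<Longrightarrow> (\<And>l. l \<in> L \<Longrightarrow> vertex_sum q y l = 0) \<Longrightarrow>
      c * mass y r \<le> edge_form b q y r"
  shows "c \<le> lam k"
  unfolding lam_def
proof (rule le_nth_eigenvalue_if_form_ge[OF condensed_carrier condensed_symmetric
      constraint_vectors(1,2)[OF IL(1,2)] _ IL(4)])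
  show "card (constraint_vectors I L) < k" using constraint_vectors(3)[OF IL(1,2)] IL(3) by simp
  fix x :: "real vec" assume "x \<in> carrier_vec r" "\<And>s. s \<in> constraint_vectors I L \<Longrightarrow> s \<bullet> x = 0"
  then show "c * (x \<bullet> x) \<le> x \<bullet> (condensed_signless_laplacian b q r *\<^sub>v x)"
    unfolding inner_self_eq_mass[OF \<open>x \<in> carrier_vec r\<close>] condensed_form_eq_edge_form[OF \<open>x \<in> carrier_vec r\<close>]
    by (intro ge constraint_vectors(4,5)[OF IL(1,2)]) auto
qed

lemma lam_le_if_edge_form_le:
  assumes IL: "I \<subseteq> {1..r}" "L \<subseteq> {..r}" "card I + card L + k \<le> r" "1 \<le> k"
    and le: "\<And>y. (\<And>i. i \<in> I \<Longrightarrow> y i = 0) \<Longrightarrow> (\<And>l. l \<in> L \<Longrightarrow> vertex_sum q y l = 0) \<Longrightarrow>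
      edge_form b q y r \<le> c * mass y r"
  shows "lam k \<le> c"
  unfolding lam_def
proof (rule nth_eigenvalue_le_if_form_le[OF condensed_carrier condensed_symmetric
      constraint_vectors(1,2)[OF IL(1,2)] _ IL(4)])
  show "card (constraint_vectors I L) + k \<le> r" using constraint_vectors(3)[OF IL(1,2)] IL(3) by simp
  fix x :: "real vec" assume "x \<in> carrier_vec r" "\<And>s. s \<in> constraint_vectors I L \<Longrightarrow> s \<bullet> x = 0"
  then show "x \<bullet> (condensed_signless_laplacian b q r *\<^sub>v x) \<le> c * (x \<bullet> x)"
    unfolding inner_self_eq_mass[OF \<open>x \<in> carrier_vec r\<close>] condensed_form_eq_edge_form[OF \<open>x \<in> carrier_vec r\<close>]
    by (intro le constraint_vectors(4,5)[OF IL(1,2)]) auto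
qed

section \<open>Bounds of the form on the test subspaces\<close>

lemma edge_form_le_zero_degree:
  assumes k: "k \<in> {1..r}" "b k = 0"
    and y: "\<And>i. i \<in> {1..r} \<Longrightarrow> \<not> (b i = 0 \<and> k \<le> i) \<Longrightarrow> y i = 0"
  shows "edge_form b q y r \<le> p k * mass y r"
proof -
  \<comment> \<open>Both ends of an edge within the first \<open>k\<close> blocks lie before the zero \<open>k\<close>, where \<open>y\<close> vanishes.\<close>
  have "edge_form b q y k = 0"
    unfolding edge_form_def
  proof (rule sum.neutral, rule ballI)
    fix j assume j: "j \<in> {1..k}"
    have "y i = 0" if "i \<in> {1..<j}" for i using y[of i] that j k by auto
    moreover have "y j = 0" if "b j \<noteq> 0" using y[of j] that j k by auto
    ultimately show "b j * ((\<Sum>i=1..<j. (sqrt (q j) * y i + sqrt (q i) * y j)\<^sup>2)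
        + 2 * (real (q j) - 1) * (y j)\<^sup>2) = 0"
      by (cases "b j = 0") auto
  qed
  moreover have "edge_form b q y r \<le> edge_form b q y k + ones_between b q k r * mass y r"
  proof (rule edge_form_tail_upper)
    show "b h = 0 \<or> b h = 1 \<and> y h = 0" if "h \<in> {k<..r}" for h
      using y[of h] b01[of h] that by auto
  qed (use k in simp)
  ultimately show ?thesis using block_degree_ones_between[OF k(1)] k(2) by simp
qed

lemma zero_degree_le_edge_form:
  assumes k: "k \<in> {1..r}" "b k = 0"
    and y: "\<And>i. i \<in> {k<..r} \<Longrightarrow> b i = 0 \<Longrightarrow> y i = 0"
    and sum0: "vertex_sum q y k = 0"
  shows "p k * mass y r \<le> edge_form b q y r"
proof -
  let ?L = "ones_between b q k r"
  have "0 \<le> edge_form b q y k" using q k by (intro edge_form_nonneg) auto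
  moreover have "?L * mass y k + (real (block_end q k) + ?L - 2) * (mass y r - mass y k)
      + (vertex_sum q y r)\<^sup>2 - (vertex_sum q y k)\<^sup>2 \<le> edge_form b q y r - edge_form b q y k"
    using b01 y k by (intro edge_form_tail_lower) auto
  moreover have "0 \<le> (real (block_end q k) - 2) * (mass y r - mass y k)"
    using two_le_block_end[of k] mass_mono[of k r y] k by (intro mult_nonneg_nonneg) auto
  moreover have "0 \<le> (vertex_sum q y r)\<^sup>2" by simp
  ultimately have "?L * mass y r \<le> edge_form b q y r" unfolding sum0 zero_power2 by (simp only: algebra_simps)
  then show ?thesis using block_degree_ones_between[OF k(1)] k(2) by simp
qed

lemma one_degree_le_edge_form:
  assumes k: "k \<in> {1..r}" "b k = 1"
    and y: "\<And>i. i \<in> {1..r} \<Longrightarrow> \<not> (b i = 1 \<and> k \<le> i) \<Longrightarrow> y i = 0"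
  shows "(p k - 1) * mass y r \<le> edge_form b q y r"
proof -
  let ?L = "ones_between b q k r"
  obtain l where l: "k = Suc l" using k by (cases k) auto
  have y0: "y i = 0" if "i \<in> {1..l}" for i using y[of i] that k l by auto
  then have "mass y l = 0" "vertex_sum q y l = 0" "edge_form b q y l = 0"
    by (simp_all add: mass_def vertex_sum_def edge_form_def)
  \<comment> \<open>The vertices of block \<open>k\<close> form a clique, and \<open>y\<close> vanishes on all earlier blocks.\<close>
  then have head: "edge_form b q y k = (real (block_end q k) - 2) * mass y k + (vertex_sum q y k)\<^sup>2"
    using k(2) unfolding l edge_form_Suc block_end_Suc mass_Suc vertex_sum_Suc
    by (simp add: power_mult_distrib algebra_simps)
  have "?L * mass y k + (real (block_end q k) + ?L - 2) * (mass y r - mass y k)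
      + (vertex_sum q y r)\<^sup>2 - (vertex_sum q y k)\<^sup>2 \<le> edge_form b q y r - edge_form b q y k"
    using b01 y k by (intro edge_form_tail_lower) auto
  moreover have "0 \<le> (vertex_sum q y r)\<^sup>2" by simp
  ultimately have "(real (block_end q k) + ?L - 2) * mass y r \<le> edge_form b q y r"
    unfolding head by (simp only: algebra_simps)
  moreover have "p k - 1 = real (block_end q k) + ?L - 2"
    using block_degree_ones_between[OF k(1)] k(2) by simp
  ultimately show ?thesis by (simp only:)
qed

lemma edge_form_le_one_degree:
  assumes k: "k \<in> {1..r}" "b k = 1"
    and y: "\<And>i. i \<in> {k<..r} \<Longrightarrow> b i = 1 \<Longrightarrow> y i = 0"
    and sum0: "vertex_sum q y k = 0"
  shows "edge_form b q y r \<le> (p k - 1) * mass y r"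
proof -
  have "edge_form b q y r \<le> edge_form b q y k + ones_between b q k r * mass y r"
  proof (rule edge_form_tail_upper)
    show "b h = 0 \<or> b h = 1 \<and> y h = 0" if "h \<in> {k<..r}" for h
      using y[of h] b01[of h] that by auto
  qed (use k in simp)
  also have "edge_form b q y k \<le> (real (block_end q k) - 2) * mass y k + (vertex_sum q y k)\<^sup>2"
    using b01 q k by (intro edge_form_le_complete) auto
  also have "\<dots> \<le> (real (block_end q k) - 2) * mass y r"
    using two_le_block_end[of k] mass_mono[of k r y] k
    unfolding sum0 by (simp add: mult_left_mono)
  finally have "edge_form b q y r
      \<le> (real (block_end q k) - 2) * mass y r + ones_between b q k r * mass y r" by simp
  moreover have "p k - 1 = (real (block_end q k) - 2) + ones_between b q k r"
    using block_degree_ones_between[OF k(1)] k(2) by simp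
  ultimately show ?thesis by (simp only: distrib_right)
qed

section \<open>Counting the blocks of each digit\<close>

lemma zero_block_iff: "h \<in> {1..r} \<Longrightarrow> b h = 0 \<longleftrightarrow> odd (h + b 1)"
proof (induction h)
  case (Suc h)
  show ?case
  proof (cases "h = 0")
    case True
    then show ?thesis using b01[of 1] r by auto
  next
    case False
    then have h: "h \<in> {1..r}" "h \<in> {1..<r}" using Suc.prems by auto
    have "b h + b (Suc h) = 1" using alternating[OF h(2)] by simp
    then show ?thesis using Suc.IH[OF h(1)] by (cases "b h = 0") auto
  qed
qed simp

text \<open>
  The number of zeros. For \<open>0 \<le> i < m\<close> they are the blocks \<open>r - b r - 2 * i\<close>, in decreasing order,
  and for \<open>1 \<le> i \<le> r - m\<close> the blocks \<open>2 * i - b 1\<close> are the ones, in increasing order.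
\<close>

definition m :: nat where
  "m = (r + 1 - b r - b 1) div 2"

lemma twice_number_of_zeros: "2 * m + b r + b 1 = r + 1"
proof -
  have "odd (r + b 1) \<longleftrightarrow> b r = 0" using zero_block_iff[of r] r by simp
  moreover have "b r \<in> {0, 1}" "b 1 \<in> {0, 1}" using b01 r by auto
  ultimately have "even (r + 1 - b r - b 1)" "b r + b 1 \<le> r + 1"
    using r by auto
  then show ?thesis unfolding m_def by simp
qed

lemma zero_block:
  assumes "j < m"
  shows "r - b r - 2 * j \<in> {1..r}" "b (r - b r - 2 * j) = 0"
proof -
  define k where "k = r - b r - 2 * j"
  have k: "k + b r + 2 * j = r" "1 + b 1 \<le> k"
    unfolding k_def using twice_number_of_zeros assms by linarith+
  then show in_range: "r - b r - 2 * j \<in> {1..r}" unfolding k_def by auto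
  have "k + b 1 + 2 * j + 1 = 2 * (m + b 1)"
    using k twice_number_of_zeros by simp
  then have "odd (k + b 1)" by presburger
  then show "b (r - b r - 2 * j) = 0" using zero_block_iff[OF in_range] unfolding k_def by simp
qed

lemma zero_blockE:
  assumes "h \<in> {1..r}" "b h = 0"
  obtains i where "i < m" "h = r - b r - 2 * i"
proof -
  have odd: "odd (h + b 1)" using zero_block_iff assms by blast
  have "h \<le> r - b r" "1 + b 1 \<le> h"
    using assms b01[of r] b01[of 1] r by (cases "h = r"; cases "h = 1"; force)+
  moreover have "even (r - b r - h)"
    using odd twice_number_of_zeros calculation by presburger
  ultimately show ?thesis
    using twice_number_of_zeros by (intro that[of "(r - b r - h) div 2"]) (auto elim!: evenE)
qed

lemma one_block:
  assumes "1 \<le> j" "j \<le> r - m"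
  shows "2 * j - b 1 \<in> {1..r}" "b (2 * j - b 1) = 1"
proof -
  let ?k = "2 * j - b 1"
  have b: "b r \<in> {0, 1}" "b 1 \<in> {0, 1}" using b01 r by auto
  then show k: "?k \<in> {1..r}" using twice_number_of_zeros assms by auto
  have "?k + b 1 = 2 * j" using b assms by auto
  then show "b ?k = 1" using zero_block_iff[OF k] b01[OF k] by simp
qed

lemma one_blockE:
  assumes "h \<in> {1..r}" "b h = 1"
  obtains i where "1 \<le> i" "i \<le> r - m" "h = 2 * i - b 1"
proof -
  have "even (h + b 1)" using zero_block_iff[OF assms(1)] assms(2) by simp
  then obtain i where i: "h + b 1 = 2 * i" by (elim evenE)
  have "h + 1 \<le> r + b r"
    using assms b01[of r] r by (cases "h = r") auto
  then have "i \<le> r - m" using i twice_number_of_zeros by simp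
  moreover have "1 \<le> i" "h = 2 * i - b 1" using i assms(1) by auto
  ultimately show ?thesis by (intro that)
qed

lemma card_zeros_after:
  "card {h \<in> {1..r}. b h = 0 \<and> r - b r - 2 * j < h} \<le> j"
proof -
  have "{h \<in> {1..r}. b h = 0 \<and> r - b r - 2 * j < h} \<subseteq> (\<lambda>i. r - b r - 2 * i) ` {..<j}"
  proof
    fix h assume h: "h \<in> {h \<in> {1..r}. b h = 0 \<and> r - b r - 2 * j < h}"
    then obtain i where i: "i < m" "h = r - b r - 2 * i" using zero_blockE by blast
    then have "i \<in> {..<j}" using h by auto
    then show "h \<in> (\<lambda>i. r - b r - 2 * i) ` {..<j}" using i by blast
  qed
  then show ?thesis using surj_card_le[of "{..<j}"] by simp
qed

lemma card_zeros_before: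
  "card {h \<in> {1..r}. b h = 0 \<and> h < r - b r - 2 * j} \<le> m - (j + 1)"
proof -
  have "{h \<in> {1..r}. b h = 0 \<and> h < r - b r - 2 * j} \<subseteq> (\<lambda>i. r - b r - 2 * i) ` {j + 1..<m}"
  proof
    fix h assume h: "h \<in> {h \<in> {1..r}. b h = 0 \<and> h < r - b r - 2 * j}"
    then obtain i where i: "i < m" "h = r - b r - 2 * i" using zero_blockE by blast
    then have "i \<in> {j + 1..<m}" using h by auto
    then show "h \<in> (\<lambda>i. r - b r - 2 * i) ` {j + 1..<m}" using i by blast
  qed
  then show ?thesis using surj_card_le[of "{j + 1..<m}"] by simp
qed

lemma card_zeros: "card {h \<in> {1..r}. b h = 0} \<le> m"
proof -
  have "{h \<in> {1..r}. b h = 0} \<subseteq> (\<lambda>i. r - b r - 2 * i) ` {..<m}"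
  proof
    fix h assume h: "h \<in> {h \<in> {1..r}. b h = 0}"
    then obtain i where i: "i < m" "h = r - b r - 2 * i" using zero_blockE by blast
    then have "i \<in> {..<m}" using h by auto
    then show "h \<in> (\<lambda>i. r - b r - 2 * i) ` {..<m}" using i by blast
  qed
  then show ?thesis using surj_card_le[of "{..<m}"] by simp
qed

lemma card_ones_after:
  "card {h \<in> {1..r}. b h = 1 \<and> 2 * j - b 1 < h} \<le> r - m - j"
proof -
  have "{h \<in> {1..r}. b h = 1 \<and> 2 * j - b 1 < h} \<subseteq> (\<lambda>i. 2 * i - b 1) ` {j + 1..r - m}"
  proof
    fix h assume h: "h \<in> {h \<in> {1..r}. b h = 1 \<and> 2 * j - b 1 < h}"
    then obtain i where i: "1 \<le> i" "i \<le> r - m" "h = 2 * i - b 1" using one_blockE by blast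
    then have "i \<in> {j + 1..r - m}" using h by auto
    then show "h \<in> (\<lambda>i. 2 * i - b 1) ` {j + 1..r - m}" using i by blast
  qed
  then show ?thesis using surj_card_le[of "{j + 1..r - m}"] by simp
qed

lemma card_ones_before:
  "card {h \<in> {1..r}. b h = 1 \<and> h < 2 * j - b 1} \<le> j - 1"
proof -
  have "{h \<in> {1..r}. b h = 1 \<and> h < 2 * j - b 1} \<subseteq> (\<lambda>i. 2 * i - b 1) ` {1..<j}"
  proof
    fix h assume h: "h \<in> {h \<in> {1..r}. b h = 1 \<and> h < 2 * j - b 1}"
    then obtain i where i: "1 \<le> i" "i \<le> r - m" "h = 2 * i - b 1" using one_blockE by blast
    then have "i \<in> {1..<j}" using h by auto
    then show "h \<in> (\<lambda>i. 2 * i - b 1) ` {1..<j}" using i by blast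
  qed
  then show ?thesis using surj_card_le[of "{1..<j}"] by simp
qed

lemma card_ones: "card {h \<in> {1..r}. b h = 1} \<le> r - m"
proof -
  have "{h \<in> {1..r}. b h = 1} \<subseteq> (\<lambda>i. 2 * i - b 1) ` {1..r - m}"
  proof
    fix h assume h: "h \<in> {h \<in> {1..r}. b h = 1}"
    then obtain i where i: "1 \<le> i" "i \<le> r - m" "h = 2 * i - b 1" using one_blockE by blast
    then have "i \<in> {1..r - m}" using h by auto
    then show "h \<in> (\<lambda>i. 2 * i - b 1) ` {1..r - m}" using i by blast
  qed
  then show ?thesis using surj_card_le[of "{1..r - m}"] by simp
qed

section \<open>The interlacing inequalities\<close>

lemma m_le_r: "m \<le> r"
  using twice_number_of_zeros r by linarith

lemma lam_nonneg: "0 \<le> lam 1"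
  by (rule le_lam_if_edge_form_ge[of "{}" "{}"]) (use r q edge_form_nonneg[of r q b] in auto)

text \<open>
  The subspace is that of vectors supported on the \<open>j + 1\<close> zeros from block \<open>r - b r - 2 * j\<close> on.
\<close>

lemma lam_le_zero_degree:
  assumes "j < m"
  shows "lam (j + 1) \<le> p (r - b r - 2 * j)"
proof -
  let ?k = "r - b r - 2 * j"
  let ?I = "{h \<in> {1..r}. b h = 1} \<union> {h \<in> {1..r}. b h = 0 \<and> h < ?k}"
  have "card ?I \<le> (r - m) + (m - (j + 1))"
    using card_Un_le card_ones card_zeros_before[of j] by (meson add_mono order_trans)
  then have "card ?I + card ({} :: nat set) + (j + 1) \<le> r" using assms m_le_r by simp
  then show ?thesis
  proof (rule lam_le_if_edge_form_le[rotated 2])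
    fix y :: "nat \<Rightarrow> real" assume "\<And>i. i \<in> ?I \<Longrightarrow> y i = 0"
    then show "edge_form b q y r \<le> p ?k * mass y r"
      using b01 by (intro edge_form_le_zero_degree zero_block[OF assms]) fastforce
  qed auto
qed

text \<open>
  Here \<open>j\<close> zeros after the block and one vertex sum are required to vanish.
\<close>

lemma zero_degree_le_lam:
  assumes "j + 1 < m"
  shows "p (r - b r - 2 * j) \<le> lam (j + 2)"
proof -
  let ?k = "r - b r - 2 * j"
  let ?I = "{h \<in> {1..r}. b h = 0 \<and> ?k < h}"
  have j: "j < m" using assms by simp
  have "card ?I + card {?k} < j + 2" using card_zeros_after[of j] by simp
  then show ?thesis
  proof (rule le_lam_if_edge_form_ge[rotated 2])
    show "j + 2 \<le> r" using assms m_le_r by simp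
    fix y :: "nat \<Rightarrow> real" assume "\<And>i. i \<in> ?I \<Longrightarrow> y i = 0" "\<And>l. l \<in> {?k} \<Longrightarrow> vertex_sum q y l = 0"
    then show "p ?k * mass y r \<le> edge_form b q y r"
      by (intro zero_degree_le_edge_form zero_block[OF j]) auto
  qed auto
qed

text \<open>
  Here \<open>m\<close> zeros and the \<open>j - 1\<close> ones before the block are required to vanish.
\<close>

lemma one_degree_le_lam:
  assumes "1 \<le> j" "j \<le> r - m"
  shows "p (2 * j - b 1) - 1 \<le> lam (m + j)"
proof -
  let ?k = "2 * j - b 1"
  let ?I = "{h \<in> {1..r}. b h = 0} \<union> {h \<in> {1..r}. b h = 1 \<and> h < ?k}"
  have "card ?I \<le> m + (j - 1)"
    using card_Un_le card_zeros card_ones_before[of j] by (meson add_mono order_trans)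
  then have "card ?I + card ({} :: nat set) < m + j" using assms by simp
  then show ?thesis
  proof (rule le_lam_if_edge_form_ge[rotated 2])
    show "m + j \<le> r" using assms by simp
    fix y :: "nat \<Rightarrow> real" assume "\<And>i. i \<in> ?I \<Longrightarrow> y i = 0"
    then show "(p ?k - 1) * mass y r \<le> edge_form b q y r"
      using b01 by (intro one_degree_le_edge_form one_block[OF assms]) fastforce
  qed auto
qed

text \<open>
  Here \<open>r - m - (j + 1)\<close> ones after the block and one vertex sum are required to vanish.
\<close>

lemma lam_le_one_degree:
  assumes "1 \<le> j" "j < r - m"
  shows "lam (m + j) \<le> p (2 * (j + 1) - b 1) - 1"
proof -
  let ?k = "2 * (j + 1) - b 1"
  let ?I = "{h \<in> {1..r}. b h = 1 \<and> ?k < h}"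
  have j: "1 \<le> j + 1" "j + 1 \<le> r - m" using assms by auto
  have "card ?I + card {?k} + (m + j) \<le> r" using card_ones_after[of "j + 1"] assms by simp
  then show ?thesis
  proof (rule lam_le_if_edge_form_le[rotated 2])
    show "{?k} \<subseteq> {..r}" using one_block(1)[OF j] by simp
    fix y :: "nat \<Rightarrow> real" assume "\<And>i. i \<in> ?I \<Longrightarrow> y i = 0" "\<And>l. l \<in> {?k} \<Longrightarrow> vertex_sum q y l = 0"
    then show "edge_form b q y r \<le> (p ?k - 1) * mass y r"
      using one_block[OF j] by (intro edge_form_le_one_degree) auto
  qed (use assms in auto)
qed

end

theorem theorem8:
  fixes b q :: "nat \<Rightarrow> nat" and r m :: nat and p lam :: "nat \<Rightarrow> real"
  assumes "r \<ge> 1"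
    and "\<And>k. k \<in> {1..r} \<Longrightarrow> b k \<in> {0, 1}"
    and "\<And>k. k \<in> {1..r} \<Longrightarrow> q k \<ge> 1"
    and "\<And>k. k \<in> {1..<r} \<Longrightarrow> b k + b (k + 1) = 1"
    and "q 1 \<ge> 2"
  defines "p \<equiv> \<lambda>k. real (block_degree b q r k)"
    and "lam \<equiv> nth_eigenvalue (condensed_signless_laplacian b q r)"
    and "m \<equiv> (r + 1 - b r - b 1) div 2"
  shows "0 \<le> lam 1 \<and>
    (\<forall>j\<in>{1..m}. lam j \<le> p (r - b r - 2 * (j - 1))) \<and>
    (\<forall>j\<in>{1..<m}. p (r - b r - 2 * (j - 1)) \<le> lam (j + 1)) \<and>
    (\<forall>j\<in>{1..r - m}. p (2 * j - b 1) - 1 \<le> lam (m + j)) \<and>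
    (\<forall>j\<in>{1..<r - m}. lam (m + j) \<le> p (2 * (j + 1) - b 1) - 1)"
proof -
  interpret s: alternating_threshold_sequence b q r
    using assms(1-5) by unfold_locales
  have eqs: "p = s.p" "lam = s.lam" "m = s.m"
    by (auto simp: p_def lam_def m_def s.p_def s.lam_def s.m_def)
  have "lam j \<le> p (r - b r - 2 * (j - 1))" if "j \<in> {1..m}" for j
    using s.lam_le_zero_degree[of "j - 1"] that unfolding eqs by (cases j) auto
  moreover have "p (r - b r - 2 * (j - 1)) \<le> lam (j + 1)" if "j \<in> {1..<m}" for j
    using s.zero_degree_le_lam[of "j - 1"] that unfolding eqs by (cases j) auto
  ultimately show ?thesis
    unfolding eqs using s.lam_nonneg s.one_degree_le_lam s.lam_le_one_degree by auto
qed

end
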